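(* Let $Z=\{z_1,z_2,\ldots\}$ be a countably infinite set, $E=\{z_2,z_4,z_6,\ldots\}$, and let $F$ be the free group on $Z$. Let $h:F\to E$, $w\mapsto h_w$, be an injective function with $h_{z_1z_2^{-1}}=z_6$, $h_{z_3z_2^{-1}}=z_8$ and $h_{z_1z_4^{-1}}=z_{10}$. Let $\mathbb{A}$ be the algebra with universe $F$, with a unary operation $\nu_c^{\mathbb{A}}(w)=cw$ for each $c\in F$ and one binary operation $g^{\mathbb{A}}(w_1,w_2)=h_{w_1w_2^{-1}}w_2$. Then the independence algebra $\mathbb{A}$ does not satisfy the distributivity condition.
   Context: A clone on a set $A$ is a set of non-nullary operations on $A$ containing all projections and closed under composition. The clone of an algebra $\mathbb{A}$ is the clone generated by its non-nullary basic operations. Distributivity condition: let $T$ be the set of non-constant unary term operations of $\mathbb{A}$. Then $\mathbb{A}$ satisfies the distributivity condition if the clone of $\mathbb{A}$ contains a generating set $W$ of operations such that for all $a\in T$ and all $n$-ary $t\in W$ with $n\ge2$ we have $a(t(x_1,\ldots,x_n))=t(a(x_1),\ldots,a(x_n))$ identically. Independence algebra: an algebra such that (i) if $y\in\langle X\cup\{z\}\rangle\setminus\langle X\rangle$ then $z\in\langle X\cup\{y\}\rangle$, where $\langle-\rangle$ is the generated-subalgebra operator; and (ii) every map from a basis (a generating set $X$ with $x\notin\langle X\setminus\{x\}\rangle$ for all $x\in X$) to the algebra extends to an endomorphism. *)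

theory Defs
  imports "HOL-Algebra.Group" HOL.Hull
begin

section \<open>The free group on a set\<close>

text \<open>Elements are reduced words.  The letter \<open>(x, True)\<close> stands for \<open>x\<close> and \<open>(x, False)\<close>
  for its formal inverse.\<close>

type_synonym 'z word = "('z \<times> bool) list"

definition inv_letter :: "'z \<times> bool \<Rightarrow> 'z \<times> bool" where
  "inv_letter l = (fst l, \<not> snd l)"

definition reduced :: "'z word \<Rightarrow> bool" where
  "reduced w \<longleftrightarrow> successively (\<lambda>l m. m \<noteq> inv_letter l) w"

text \<open>The reduced form of \<open>l # w\<close>, for a reduced word \<open>w\<close>.\<close>

fun push :: "'z \<times> bool \<Rightarrow> 'z word \<Rightarrow> 'z word" where
  "push l [] = [l]"
| "push l (m # w) = (if m = inv_letter l then w else l # m # w)"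

definition free_group :: "'z set \<Rightarrow> 'z word monoid" where
  "free_group Z =
    \<lparr>carrier = {w. reduced w \<and> fst ` set w \<subseteq> Z}, mult = (\<lambda>u v. foldr push u v), one = []\<rparr>"

definition gen :: "'z \<Rightarrow> 'z word" where
  "gen x = [(x, True)]"

lemma inv_letter_inv_letter [simp]: "inv_letter (inv_letter l) = l"
  by (simp add: inv_letter_def)

lemma fst_inv_letter [simp]: "fst (inv_letter l) = fst l"
  by (simp add: inv_letter_def)

lemma inv_letter_neq [simp]: "inv_letter l \<noteq> l" "l \<noteq> inv_letter l"
  by (cases l; simp add: inv_letter_def)+

lemma reduced_simps [simp]:
  "reduced []" "reduced [l]"
  "reduced (l # m # w) \<longleftrightarrow> m \<noteq> inv_letter l \<and> reduced (m # w)"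
  by (simp_all add: reduced_def)

lemma reduced_tl: "reduced (l # w) \<Longrightarrow> reduced w"
  by (cases w) auto

lemma reduced_push: "reduced w \<Longrightarrow> reduced (push l w)"
  by (cases w) (auto dest: reduced_tl)

lemma push_push_inv: "reduced w \<Longrightarrow> push l (push (inv_letter l) w) = w"
proof (cases w)
  case (Cons m w')
  then show "reduced w \<Longrightarrow> ?thesis" by (cases w') auto
qed simp

lemma push_inv_push: "reduced w \<Longrightarrow> push (inv_letter l) (push l w) = w"
  using push_push_inv[of w "inv_letter l"] by simp

lemma reduced_foldr_push: "reduced w \<Longrightarrow> reduced (foldr push u w)"
  by (induction u) (auto intro: reduced_push)

lemma set_push: "set (push l w) \<subseteq> insert l (set w)"
  by (cases w) auto

lemma set_foldr_push: "set (foldr push u w) \<subseteq> set u \<union> set w"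
proof (induction u)
  case (Cons l u)
  then show ?case using set_push[of l "foldr push u w"] by auto
qed simp

lemma push_eq_Cons: "reduced (l # w) \<Longrightarrow> push l w = l # w"
  by (cases w) auto

lemma foldr_push_Nil: "reduced w \<Longrightarrow> foldr push w [] = w"
proof (induction w)
  case (Cons l w)
  then show ?case using reduced_tl[of l w] push_eq_Cons[of l w] by simp
qed simp

lemma foldr_push_push:
  "reduced v \<Longrightarrow> reduced w \<Longrightarrow> foldr push (push l v) w = push l (foldr push v w)"
  by (cases v) (auto simp: push_push_inv reduced_foldr_push)

lemma foldr_push_assoc:
  assumes "reduced v" "reduced w"
  shows "foldr push (foldr push u v) w = foldr push u (foldr push v w)"
  by (induction u) (auto simp: assms foldr_push_push reduced_foldr_push)

lemma foldr_push_rev_inv: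
  "reduced w \<Longrightarrow> foldr push (rev (map inv_letter u)) (foldr push u w) = w"
  by (induction u arbitrary: w) (auto simp: push_inv_push reduced_foldr_push)

lemma group_free_group: "group (free_group Z)"
proof (rule groupI)
  fix u assume u: "u \<in> carrier (free_group Z)"
  let ?v = "foldr push (rev (map inv_letter u)) []"
  have "foldr push ?v u = foldr push (rev (map inv_letter u)) (foldr push [] u)"
    using u by (intro foldr_push_assoc) (auto simp: free_group_def)
  also have "\<dots> = foldr push (rev (map inv_letter u)) (foldr push u [])"
    using u by (simp add: foldr_push_Nil free_group_def)
  also have "\<dots> = []"
    by (rule foldr_push_rev_inv) simp
  finally have "foldr push ?v u = []" .
  moreover have "?v \<in> carrier (free_group Z)"
    using u set_foldr_push[of "rev (map inv_letter u)" "[]"]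
    by (fastforce simp: free_group_def reduced_foldr_push)
  ultimately show "\<exists>v\<in>carrier (free_group Z). v \<otimes>\<^bsub>free_group Z\<^esub> u = \<one>\<^bsub>free_group Z\<^esub>"
    by (auto simp: free_group_def)
next
  fix u v assume "u \<in> carrier (free_group Z)" "v \<in> carrier (free_group Z)"
  then show "u \<otimes>\<^bsub>free_group Z\<^esub> v \<in> carrier (free_group Z)"
    using set_foldr_push[of u v] by (fastforce simp: free_group_def reduced_foldr_push)
qed (auto simp: free_group_def foldr_push_assoc)

lemma gen_in_free_group: "x \<in> Z \<Longrightarrow> gen x \<in> carrier (free_group Z)"
  by (simp add: gen_def free_group_def)

definition letter_value :: "('b, 'm) monoid_scheme \<Rightarrow> ('z \<Rightarrow> 'b) \<Rightarrow> 'z \<times> bool \<Rightarrow> 'b" where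
  "letter_value G f l = (if snd l then f (fst l) else inv\<^bsub>G\<^esub> f (fst l))"

lemma free_group_universal_property:
  assumes G: "group G" and f: "f \<in> Z \<rightarrow> carrier G"
  shows "\<exists>!\<phi>. \<phi> \<in> hom (free_group Z) G \<and> \<phi> \<in> extensional (carrier (free_group Z))
    \<and> (\<forall>x\<in>Z. \<phi> (gen x) = f x)"
proof -
  interpret G: group G by (rule G)
  interpret F: group "free_group Z" by (rule group_free_group)
  let ?v = "letter_value G f"
  let ?e = "\<lambda>w. foldr (\<lambda>l b. ?v l \<otimes>\<^bsub>G\<^esub> b) w \<one>\<^bsub>G\<^esub>"
  have v: "?v l \<in> carrier G" if "fst l \<in> Z" for l
    using f that by (auto simp: letter_value_def)
  have vi: "?v (inv_letter l) = inv\<^bsub>G\<^esub> ?v l" if "fst l \<in> Z" for l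
    using f that funcset_mem[OF f that] by (auto simp: letter_value_def inv_letter_def)
  have e: "?e w \<in> carrier G" if "fst ` set w \<subseteq> Z" for w
    using that by (induction w) (auto simp: v)
  have ep: "?e (push l w) = ?v l \<otimes>\<^bsub>G\<^esub> ?e w" if "fst l \<in> Z" "fst ` set w \<subseteq> Z" for l w
  proof (cases w)
    case (Cons m w')
    have "?v l \<otimes>\<^bsub>G\<^esub> (inv\<^bsub>G\<^esub> ?v l \<otimes>\<^bsub>G\<^esub> ?e w') = ?e w'"
      using that Cons by (simp add: v e G.m_assoc[symmetric])
    with Cons that show ?thesis by (auto simp: vi)
  qed simp
  have em: "?e (foldr push u w) = ?e u \<otimes>\<^bsub>G\<^esub> ?e w"
    if "fst ` set u \<subseteq> Z" "fst ` set w \<subseteq> Z" for u w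
    using that(1)
  proof (induction u)
    case (Cons l u)
    have "fst ` set (foldr push u w) \<subseteq> Z"
      using Cons.prems that(2) set_foldr_push[of u w] by fastforce
    with Cons that(2) show ?case by (simp add: ep v e G.m_assoc)
  qed (simp add: e that)
  let ?\<phi> = "restrict ?e (carrier (free_group Z))"
  show ?thesis
  proof (rule ex1I[of _ ?\<phi>])
    have "?\<phi> \<in> hom (free_group Z) G"
    proof (rule homI)
      fix u w assume uw: "u \<in> carrier (free_group Z)" "w \<in> carrier (free_group Z)"
      then have "u \<otimes>\<^bsub>free_group Z\<^esub> w \<in> carrier (free_group Z)" by simp
      then show "?\<phi> (u \<otimes>\<^bsub>free_group Z\<^esub> w) = ?\<phi> u \<otimes>\<^bsub>G\<^esub> ?\<phi> w"
        using uw em[of u w] by (simp add: free_group_def)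
    qed (use e in \<open>auto simp: free_group_def\<close>)
    moreover have "?\<phi> (gen x) = f x" if "x \<in> Z" for x
      using that funcset_mem[OF f that] gen_in_free_group[OF that] by (auto simp: gen_def letter_value_def)
    ultimately show "?\<phi> \<in> hom (free_group Z) G \<and> ?\<phi> \<in> extensional (carrier (free_group Z))
        \<and> (\<forall>x\<in>Z. ?\<phi> (gen x) = f x)" by simp
  next
    fix \<psi> assume \<psi>: "\<psi> \<in> hom (free_group Z) G \<and> \<psi> \<in> extensional (carrier (free_group Z))
        \<and> (\<forall>x\<in>Z. \<psi> (gen x) = f x)"
    interpret h: group_hom "free_group Z" G \<psi>
      using \<psi> by unfold_locales auto
    have l: "\<psi> [l] = ?v l" if "fst l \<in> Z" for l
    proof (cases "snd l")
      case True
      then have "[l] = gen (fst l)" by (cases l) (simp add: gen_def)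
      with True that \<psi> show ?thesis by (simp add: letter_value_def)
    next
      case False
      have g: "gen (fst l) \<in> carrier (free_group Z)" by (rule gen_in_free_group[OF that])
      have "[l] \<otimes>\<^bsub>free_group Z\<^esub> gen (fst l) = \<one>\<^bsub>free_group Z\<^esub>"
        using False by (cases l) (simp add: free_group_def gen_def inv_letter_def)
      moreover have "[l] \<in> carrier (free_group Z)"
        using that by (simp add: free_group_def)
      ultimately have "[l] = inv\<^bsub>free_group Z\<^esub> gen (fst l)"
        using g F.inv_equality by metis
      with False that \<psi> g show ?thesis by (simp add: letter_value_def)
    qed
    have "\<psi> w = ?e w" if "reduced w" "fst ` set w \<subseteq> Z" for w
      using that
    proof (induction w)
      case Nil
      then show ?case using h.hom_one by (simp add: free_group_def)
    next
      case (Cons m w)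
      have "m # w = [m] \<otimes>\<^bsub>free_group Z\<^esub> w"
        using Cons.prems by (simp add: free_group_def push_eq_Cons)
      moreover have "[m] \<in> carrier (free_group Z)" "w \<in> carrier (free_group Z)"
        using Cons.prems by (auto simp: free_group_def dest: reduced_tl)
      ultimately have "\<psi> (m # w) = \<psi> [m] \<otimes>\<^bsub>G\<^esub> \<psi> w"
        by (metis h.hom_mult)
      with Cons show ?case by (auto simp: l dest: reduced_tl)
    qed
    with \<psi> show "\<psi> = ?\<phi>"
      by (intro extensionalityI[of _ "carrier (free_group Z)"]) (auto simp: free_group_def)
  qed
qed


section \<open>Operations and clones\<close>

definition tuples :: "'a set \<Rightarrow> nat \<Rightarrow> 'a list set" where
  "tuples A n = {xs. length xs = n \<and> set xs \<subseteq> A}"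

text \<open>An operation carries its arity, and its function is undefined outside the tuples of that
  length, so that equality of operations is equality on \<open>A\<close>.\<close>

type_synonym 'a operation = "nat \<times> ('a list \<Rightarrow> 'a)"

definition operations :: "'a set \<Rightarrow> 'a operation set" where
  "operations A = {(n, f). n \<ge> 1 \<and> f \<in> tuples A n \<rightarrow>\<^sub>E A}"

definition proj_fun :: "'a set \<Rightarrow> nat \<Rightarrow> nat \<Rightarrow> 'a list \<Rightarrow> 'a" where
  "proj_fun A n i = restrict (\<lambda>xs. xs ! i) (tuples A n)"

definition comp_fun :: "'a set \<Rightarrow> nat \<Rightarrow> ('a list \<Rightarrow> 'a) \<Rightarrow> ('a list \<Rightarrow> 'a) list \<Rightarrow> 'a list \<Rightarrow> 'a" where
  "comp_fun A n f gs = restrict (\<lambda>xs. f (map (\<lambda>g. g xs) gs)) (tuples A n)"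

definition is_clone :: "'a set \<Rightarrow> 'a operation set \<Rightarrow> bool" where
  "is_clone A C \<longleftrightarrow>
    C \<subseteq> operations A \<and>
    (\<forall>n. \<forall>i<n. (n, proj_fun A n i) \<in> C) \<and>
    (\<forall>m f n gs. (m, f) \<in> C \<longrightarrow> length gs = m \<longrightarrow> (\<forall>g\<in>set gs. (n, g) \<in> C) \<longrightarrow>
      (n, comp_fun A n f gs) \<in> C)"

definition generated_clone :: "'a set \<Rightarrow> 'a operation set \<Rightarrow> 'a operation set" where
  "generated_clone A S = (is_clone A) hull S"

lemma is_clone_operations: "is_clone A (operations A)"
  unfolding is_clone_def
proof (intro conjI allI impI)
  fix n i :: nat assume "i < n"
  then show "(n, proj_fun A n i) \<in> operations A"
    by (auto simp: operations_def proj_fun_def tuples_def)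
next
  fix m n :: nat and f :: "'a list \<Rightarrow> 'a" and gs
  assume f: "(m, f) \<in> operations A" and gs: "length gs = m" "\<forall>g\<in>set gs. (n, g) \<in> operations A"
  from f gs have "gs \<noteq> []" by (auto simp: operations_def)
  with gs(2) have "n \<ge> 1" by (cases gs) (auto simp: operations_def)
  moreover have "f (map (\<lambda>g. g xs) gs) \<in> A" if "xs \<in> tuples A n" for xs
  proof -
    have "map (\<lambda>g. g xs) gs \<in> tuples A m"
      using gs that PiE_mem by (auto simp: operations_def tuples_def[of A m])
    then show ?thesis using f by (auto simp: operations_def)
  qed
  ultimately show "(n, comp_fun A n f gs) \<in> operations A"
    by (auto simp: operations_def comp_fun_def)
qed simp

lemma is_clone_generated_clone:
  assumes "S \<subseteq> operations A"
  shows "is_clone A (generated_clone A S)"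
proof -
  have sub: "generated_clone A S \<subseteq> operations A"
    using assms is_clone_operations[of A] by (auto simp: generated_clone_def hull_def)
  show ?thesis
    unfolding is_clone_def
  proof (intro conjI allI impI)
    fix m f n gs
    assume f: "(m, f) \<in> generated_clone A S" and m: "length gs = m"
      and gs: "\<forall>g\<in>set gs. (n, g) \<in> generated_clone A S"
    show "(n, comp_fun A n f gs) \<in> generated_clone A S"
      unfolding generated_clone_def hull_def
    proof (rule InterI, elim CollectE conjE)
      fix C assume C: "is_clone A C" "S \<subseteq> C"
      then have "generated_clone A S \<subseteq> C"
        by (auto simp: generated_clone_def hull_def)
      with f gs have "(m, f) \<in> C" "\<forall>g\<in>set gs. (n, g) \<in> C" by auto
      with C(1) m show "(n, comp_fun A n f gs) \<in> C" unfolding is_clone_def by simp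
    qed
  qed (use sub in \<open>auto simp: generated_clone_def hull_def is_clone_def\<close>)
qed


section \<open>Algebras\<close>

text \<open>Nullary symbols are allowed.  The interpretation of a symbol matters only on tuples over the
  carrier of the right length.\<close>

record ('a, 'f) univ_algebra = "'a partial_object" +
  symbols :: "'f set"
  arity :: "'f \<Rightarrow> nat"
  interp :: "'f \<Rightarrow> 'a list \<Rightarrow> 'a"

definition is_algebra :: "('a, 'f, 'm) univ_algebra_scheme \<Rightarrow> bool" where
  "is_algebra \<AA> \<longleftrightarrow>
    (\<forall>f\<in>symbols \<AA>. interp \<AA> f \<in> tuples (carrier \<AA>) (arity \<AA> f) \<rightarrow> carrier \<AA>)"

definition clone_of :: "('a, 'f, 'm) univ_algebra_scheme \<Rightarrow> 'a operation set" where
  "clone_of \<AA> = generated_clone (carrier \<AA>)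
    {(arity \<AA> f, restrict (interp \<AA> f) (tuples (carrier \<AA>) (arity \<AA> f))) | f.
      f \<in> symbols \<AA> \<and> arity \<AA> f \<ge> 1}"

text \<open>The \<open>n\<close>-ary term operations: those given by terms in \<open>n\<close> variables, which may involve
  nullary symbols.\<close>

inductive_set term_ops :: "('a, 'f, 'm) univ_algebra_scheme \<Rightarrow> nat \<Rightarrow> ('a list \<Rightarrow> 'a) set"
  for \<AA> :: "('a, 'f, 'm) univ_algebra_scheme" and n :: nat where
  var: "i < n \<Longrightarrow> proj_fun (carrier \<AA>) n i \<in> term_ops \<AA> n"
| app: "f \<in> symbols \<AA> \<Longrightarrow> length ts = arity \<AA> f \<Longrightarrow> \<forall>t\<in>set ts. t \<in> term_ops \<AA> n \<Longrightarrow>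
    comp_fun (carrier \<AA>) n (interp \<AA> f) ts \<in> term_ops \<AA> n"

definition nonconstant_unary_term_ops :: "('a, 'f, 'm) univ_algebra_scheme \<Rightarrow> ('a list \<Rightarrow> 'a) set"
  where
  "nonconstant_unary_term_ops \<AA> =
    {a \<in> term_ops \<AA> 1. \<exists>x\<in>carrier \<AA>. \<exists>y\<in>carrier \<AA>. a [x] \<noteq> a [y]}"

definition distributivity_condition :: "('a, 'f, 'm) univ_algebra_scheme \<Rightarrow> bool" where
  "distributivity_condition \<AA> \<longleftrightarrow>
    (\<exists>W \<subseteq> clone_of \<AA>. generated_clone (carrier \<AA>) W = clone_of \<AA> \<and>
      (\<forall>a\<in>nonconstant_unary_term_ops \<AA>. \<forall>(n, t)\<in>W. n \<ge> 2 \<longrightarrow>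
        (\<forall>xs\<in>tuples (carrier \<AA>) n. a [t xs] = t (map (\<lambda>x. a [x]) xs))))"

definition is_subuniverse :: "('a, 'f, 'm) univ_algebra_scheme \<Rightarrow> 'a set \<Rightarrow> bool" where
  "is_subuniverse \<AA> S \<longleftrightarrow>
    S \<subseteq> carrier \<AA> \<and> (\<forall>f\<in>symbols \<AA>. \<forall>xs\<in>tuples S (arity \<AA> f). interp \<AA> f xs \<in> S)"

definition generated_subalgebra :: "('a, 'f, 'm) univ_algebra_scheme \<Rightarrow> 'a set \<Rightarrow> 'a set" where
  "generated_subalgebra \<AA> X = (is_subuniverse \<AA>) hull X"

definition is_basis :: "('a, 'f, 'm) univ_algebra_scheme \<Rightarrow> 'a set \<Rightarrow> bool" where
  "is_basis \<AA> X \<longleftrightarrow>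
    X \<subseteq> carrier \<AA> \<and> generated_subalgebra \<AA> X = carrier \<AA> \<and>
    (\<forall>x\<in>X. x \<notin> generated_subalgebra \<AA> (X - {x}))"

definition is_endomorphism :: "('a, 'f, 'm) univ_algebra_scheme \<Rightarrow> ('a \<Rightarrow> 'a) \<Rightarrow> bool" where
  "is_endomorphism \<AA> \<phi> \<longleftrightarrow>
    \<phi> \<in> carrier \<AA> \<rightarrow> carrier \<AA> \<and>
    (\<forall>f\<in>symbols \<AA>. \<forall>xs\<in>tuples (carrier \<AA>) (arity \<AA> f).
      \<phi> (interp \<AA> f xs) = interp \<AA> f (map \<phi> xs))"

definition independence_algebra :: "('a, 'f, 'm) univ_algebra_scheme \<Rightarrow> bool" where
  "independence_algebra \<AA> \<longleftrightarrow>
    is_algebra \<AA> \<and>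
    (\<forall>X y z. X \<subseteq> carrier \<AA> \<longrightarrow> y \<in> carrier \<AA> \<longrightarrow> z \<in> carrier \<AA> \<longrightarrow>
      y \<in> generated_subalgebra \<AA> (X \<union> {z}) - generated_subalgebra \<AA> X \<longrightarrow>
      z \<in> generated_subalgebra \<AA> (X \<union> {y})) \<and>
    (\<forall>X \<alpha>. is_basis \<AA> X \<longrightarrow> \<alpha> \<in> X \<rightarrow> carrier \<AA> \<longrightarrow>
      (\<exists>\<phi>. is_endomorphism \<AA> \<phi> \<and> (\<forall>x\<in>X. \<phi> x = \<alpha> x)))"


section \<open>The algebra on the free group\<close>

datatype 'c symb = Sym_nu 'c | Sym_g

text \<open>Here \<open>h\<close> takes values in the generating set \<open>Z\<close>, which is embedded in the free group
  by \<^const>\<open>gen\<close>.\<close>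

definition free_group_algebra ::
  "'z set \<Rightarrow> ('z word \<Rightarrow> 'z) \<Rightarrow> ('z word, 'z word symb) univ_algebra" where
  "free_group_algebra Z h =
    \<lparr>carrier = carrier (free_group Z),
     symbols = Sym_nu ` carrier (free_group Z) \<union> {Sym_g},
     arity = (\<lambda>s. case s of Sym_nu c \<Rightarrow> 1 | Sym_g \<Rightarrow> 2),
     interp = (\<lambda>s xs. case s of
         Sym_nu c \<Rightarrow> c \<otimes>\<^bsub>free_group Z\<^esub> xs ! 0
       | Sym_g \<Rightarrow> gen (h (xs ! 0 \<otimes>\<^bsub>free_group Z\<^esub> inv\<^bsub>free_group Z\<^esub> (xs ! 1))) \<otimes>\<^bsub>free_group Z\<^esub> xs ! 1)\<rparr>"

end

theory Submission
  imports Defs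
begin

text \<open>
  All basic operations commute with right translations, and the left translations act transitively;
  so the bases are the singletons, and right translations provide the required endomorphisms.

  Every operation \<open>t\<close> in the clone moves one of its arguments only by a bounded amount:
  the word length of \<open>t(x\<^sub>1, \<dots>, x\<^sub>n) x\<^sub>i\<^sup>-\<^sup>1\<close> is bounded for some \<open>i\<close>.  If \<open>t\<close> also commutes with left
  translations, then replacing \<open>x\<^sub>1, \<dots>, x\<^sub>n\<close> by \<open>c x\<^sub>1, \<dots>, c x\<^sub>n\<close> conjugates this element by \<open>c\<close>.  Only
  the identity has conjugates of bounded length, so \<open>t\<close> is a projection.  Thus the distributivity
  condition would make every operation in the clone essentially unary, which \<open>g\<close> is not.
\<close>

section \<open>Word length in free groups\<close>

lemma mult_free_group: "u \<otimes>\<^bsub>free_group Z\<^esub> v = foldr push u v"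
  by (simp add: free_group_def)

lemma one_free_group: "\<one>\<^bsub>free_group Z\<^esub> = []"
  by (simp add: free_group_def)

lemma foldr_push_append:
  assumes "reduced (u @ v)"
  shows "foldr push u v = u @ v"
proof -
  have "reduced v"
    using assms by (simp add: reduced_def successively_append_iff)
  then show ?thesis
    using foldr_push_Nil[OF assms] by (simp add: foldr_push_Nil)
qed

lemma length_push_le: "length (push l w) \<le> Suc (length w)"
  by (cases w) auto

text \<open>Pushing a letter either cancels one or adds one. This subadditivity later serves as the
  triangle inequality for displacements.\<close>

lemma length_mult_free_group_le: "length (u \<otimes>\<^bsub>free_group Z\<^esub> v) \<le> length u + length v"
proof -
  have "length (foldr push u v) \<le> length u + length v"
  proof (induction u)
    case (Cons l u)
    then show ?case using length_push_le[of l "foldr push u v"] by simp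
  qed simp
  then show ?thesis by (simp add: mult_free_group)
qed

lemma reduced_replicate: "reduced (replicate k l)"
  by (simp add: reduced_def successively_conv_nth)

lemma replicate_in_free_group:
  "fst l \<in> Z \<Longrightarrow> replicate k l \<in> carrier (free_group Z)"
  by (auto simp: free_group_def reduced_replicate)

lemma inv_replicate:
  assumes "fst l \<in> Z"
  shows "inv\<^bsub>free_group Z\<^esub> replicate k l = replicate k (inv_letter l)"
proof -
  interpret group "free_group Z" by (rule group_free_group)
  \<comment> \<open>The formal inverse word is a left inverse; for a power of a single letter, the
    reversal changes nothing.\<close>
  have "foldr push (rev (map inv_letter (replicate k l))) (foldr push (replicate k l) []) = []"
    by (rule foldr_push_rev_inv) simp
  then have "replicate k (inv_letter l) \<otimes>\<^bsub>free_group Z\<^esub> replicate k l = \<one>\<^bsub>free_group Z\<^esub>"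
    by (simp add: mult_free_group one_free_group foldr_push_Nil reduced_replicate del: foldr_replicate)
  then show ?thesis
    using assms by (intro inv_equality) (simp_all add: replicate_in_free_group)
qed

text \<open>A nonempty \<open>p\<close> is conjugated by a high power of a generator absent from
  \<open>p\<close>. Nothing cancels, so the conjugate is longer than twice the exponent, and the
  exponent \<open>Suc B\<close> already exceeds the bound.\<close>

lemma conjugates_bounded_imp_Nil:
  assumes "infinite Z" and p: "p \<in> carrier (free_group Z)"
    and B: "\<And>c. c \<in> carrier (free_group Z) \<Longrightarrow>
      length (c \<otimes>\<^bsub>free_group Z\<^esub> p \<otimes>\<^bsub>free_group Z\<^esub> inv\<^bsub>free_group Z\<^esub> c) \<le> B"
  shows "p = []"
proof (rule ccontr)
  assume "p \<noteq> []"
  obtain x where x: "x \<in> Z" "x \<notin> fst ` set p"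
    using \<open>infinite Z\<close> by (metis List.finite_set finite_imageI finite_subset subsetI)
  define c where "c = replicate (Suc B) (x, True)"
  let ?d = "replicate (Suc B) (x, False)"
  have inv_c: "inv\<^bsub>free_group Z\<^esub> c = ?d"
    using x inv_replicate[of "(x, True)" Z] by (simp add: c_def inv_letter_def del: replicate_Suc)
  have c: "c \<in> carrier (free_group Z)"
    using x replicate_in_free_group[of "(x, True)"] by (simp add: c_def del: replicate_Suc)
  \<comment> \<open>Since \<open>x\<close> does not occur in \<open>p\<close>, there is no
    cancellation at either end of \<open>p\<close>.\<close>
  have "hd p \<noteq> inv_letter (x, True)" "(x, False) \<noteq> inv_letter (last p)"
    using x(2) imageI[OF hd_in_set[OF \<open>p \<noteq> []\<close>], of fst] imageI[OF last_in_set[OF \<open>p \<noteq> []\<close>], of fst]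
    by (metis fst_conv fst_inv_letter)+
  then have cpd: "reduced ((c @ p) @ ?d)"
    using p \<open>p \<noteq> []\<close> reduced_replicate[of "Suc B" "(x, True)"] reduced_replicate[of "Suc B" "(x, False)"]
    unfolding c_def free_group_def reduced_def
    by (simp add: successively_append_iff del: replicate_Suc)
  \<comment> \<open>The product is evaluated from the left, so the prefix \<open>c @ p\<close> must
    be reduced as well.\<close>
  then have "reduced (c @ p)"
    by (simp only: reduced_def successively_append_iff)
  with cpd have "c \<otimes>\<^bsub>free_group Z\<^esub> p \<otimes>\<^bsub>free_group Z\<^esub> inv\<^bsub>free_group Z\<^esub> c = (c @ p) @ ?d"
    by (simp only: mult_free_group inv_c foldr_push_append)
  with B[OF c] show False by (simp add: c_def)
qed


section \<open>Essentially unary operations and operations of bounded displacement\<close>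

lemma generated_clone_minimal:
  "S \<subseteq> C \<Longrightarrow> is_clone A C \<Longrightarrow> generated_clone A S \<subseteq> C"
  unfolding generated_clone_def by (rule hull_minimal)

lemma subset_generated_clone: "S \<subseteq> generated_clone A S"
  unfolding generated_clone_def by (rule hull_subset)

lemma operationsD: "(n, f) \<in> operations A \<Longrightarrow> xs \<in> tuples A n \<Longrightarrow> f xs \<in> A"
  by (auto simp: operations_def)

lemma map_in_tuples:
  assumes "length gs = m" "\<forall>g\<in>set gs. (n, g) \<in> operations A" "xs \<in> tuples A n"
  shows "map (\<lambda>g. g xs) gs \<in> tuples A m"
  using assms operationsD[of n _ A xs] by (auto simp: tuples_def[of A m])

text \<open>Dependence on a single coordinate is stated without naming a unary function.
  Projections, constants and all unary operations qualify.\<close>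

definition essentially_unary :: "'a set \<Rightarrow> 'a operation set" where
  "essentially_unary A = {(n, f) \<in> operations A.
    \<exists>i<n. \<forall>xs\<in>tuples A n. \<forall>ys\<in>tuples A n. xs ! i = ys ! i \<longrightarrow> f xs = f ys}"

text \<open>If \<open>f\<close> depends only on argument \<open>i\<close>, and \<open>gs ! i\<close>
  only on argument \<open>j\<close>, then the composite depends only on argument
  \<open>j\<close>.\<close>

lemma is_clone_essentially_unary: "is_clone A (essentially_unary A)"
  unfolding is_clone_def
proof (intro conjI allI impI)
  fix n i :: nat assume "i < n"
  then show "(n, proj_fun A n i) \<in> essentially_unary A"
    using is_clone_operations[of A] by (auto simp: essentially_unary_def is_clone_def proj_fun_def)
next
  fix m n :: nat and f :: "'a list \<Rightarrow> 'a" and gs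
  assume f: "(m, f) \<in> essentially_unary A" and m: "length gs = m"
    and gs: "\<forall>g\<in>set gs. (n, g) \<in> essentially_unary A"
  have ops: "(m, f) \<in> operations A" "\<forall>g\<in>set gs. (n, g) \<in> operations A"
    using f gs by (auto simp: essentially_unary_def)
  with m have comp: "(n, comp_fun A n f gs) \<in> operations A"
    using is_clone_operations[of A] unfolding is_clone_def by blast
  obtain i where i: "i < m"
    "\<And>xs ys. xs \<in> tuples A m \<Longrightarrow> ys \<in> tuples A m \<Longrightarrow> xs ! i = ys ! i \<Longrightarrow> f xs = f ys"
    using f unfolding essentially_unary_def by blast
  have "(n, gs ! i) \<in> essentially_unary A"
    using gs i(1) m by simp
  then obtain j where j: "j < n"
    "\<And>xs ys. xs \<in> tuples A n \<Longrightarrow> ys \<in> tuples A n \<Longrightarrow> xs ! j = ys ! j \<Longrightarrow> (gs ! i) xs = (gs ! i) ys"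
    unfolding essentially_unary_def by blast
  have "comp_fun A n f gs xs = comp_fun A n f gs ys"
    if xy: "xs \<in> tuples A n" "ys \<in> tuples A n" "xs ! j = ys ! j" for xs ys
  proof -
    have "f (map (\<lambda>g. g xs) gs) = f (map (\<lambda>g. g ys) gs)"
      using i m j(2)[OF xy] xy ops(2) by (intro i(2) map_in_tuples) auto
    with xy show ?thesis by (simp add: comp_fun_def)
  qed
  with comp j(1) show "(n, comp_fun A n f gs) \<in> essentially_unary A"
    unfolding essentially_unary_def by blast
qed (auto simp: essentially_unary_def)

text \<open>The length of \<open>u v^-1\<close> is the right-invariant word metric, so
  \<open>f\<close> stays within distance \<open>B\<close> of a projection. Both \<open>i\<close> and
  \<open>B\<close> are uniform in \<open>xs\<close>.\<close>

definition bounded_displacement :: "'z set \<Rightarrow> 'z word operation set" where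
  "bounded_displacement Z = {(n, f) \<in> operations (carrier (free_group Z)).
    \<exists>i<n. \<exists>B. \<forall>xs\<in>tuples (carrier (free_group Z)) n.
      length (f xs \<otimes>\<^bsub>free_group Z\<^esub> inv\<^bsub>free_group Z\<^esub> (xs ! i)) \<le> B}"

text \<open>Projections have displacement the identity. For a composite, follow \<open>f\<close> to
  its argument \<open>i\<close> and then \<open>gs ! i\<close> to its argument \<open>j\<close>; the
  two bounds add.\<close>

lemma is_clone_bounded_displacement:
  "is_clone (carrier (free_group Z)) (bounded_displacement Z)"
  unfolding is_clone_def
proof (intro conjI allI impI)
  interpret group "free_group Z" by (rule group_free_group)
  let ?A = "carrier (free_group Z)"
  {
    fix n i :: nat assume i: "i < n"
    have "proj_fun ?A n i xs \<otimes>\<^bsub>free_group Z\<^esub> inv\<^bsub>free_group Z\<^esub> (xs ! i) = []"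
      if "xs \<in> tuples ?A n" for xs
      using that i by (auto simp: proj_fun_def tuples_def one_free_group subset_code(1))
    moreover have "(n, proj_fun ?A n i) \<in> operations ?A"
      using is_clone_operations[of ?A] i by (auto simp: is_clone_def)
    ultimately show "(n, proj_fun ?A n i) \<in> bounded_displacement Z"
      using i unfolding bounded_displacement_def by fastforce
  }
  fix m n :: nat and f gs
  assume f: "(m, f) \<in> bounded_displacement Z" and m: "length gs = m"
    and gs: "\<forall>g\<in>set gs. (n, g) \<in> bounded_displacement Z"
  have ops: "(m, f) \<in> operations ?A" "\<forall>g\<in>set gs. (n, g) \<in> operations ?A"
    using f gs by (auto simp: bounded_displacement_def)
  with m have comp: "(n, comp_fun ?A n f gs) \<in> operations ?A"
    using is_clone_operations[of ?A] unfolding is_clone_def by blast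
  obtain i B where i: "i < m" "\<And>xs. xs \<in> tuples ?A m \<Longrightarrow>
      length (f xs \<otimes>\<^bsub>free_group Z\<^esub> inv\<^bsub>free_group Z\<^esub> (xs ! i)) \<le> B"
    using f unfolding bounded_displacement_def by blast
  have "(n, gs ! i) \<in> bounded_displacement Z"
    using gs i(1) m by simp
  then obtain j B' where j: "j < n" "\<And>xs. xs \<in> tuples ?A n \<Longrightarrow>
      length ((gs ! i) xs \<otimes>\<^bsub>free_group Z\<^esub> inv\<^bsub>free_group Z\<^esub> (xs ! j)) \<le> B'"
    unfolding bounded_displacement_def by blast
  have "length (comp_fun ?A n f gs xs \<otimes>\<^bsub>free_group Z\<^esub> inv\<^bsub>free_group Z\<^esub> (xs ! j)) \<le> B + B'"
    if xs: "xs \<in> tuples ?A n" for xs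
  proof -
    let ?ys = "map (\<lambda>g. g xs) gs"
    have ys: "?ys \<in> tuples ?A m"
      using map_in_tuples[OF m ops(2) xs] .
    have in_A: "f ?ys \<in> ?A" "?ys ! i \<in> ?A" "xs ! j \<in> ?A"
      using operationsD[OF ops(1) ys] ys xs i(1) j(1) nth_mem by (auto simp: tuples_def)
    \<comment> \<open>The intermediate point \<open>?ys ! i\<close> and its inverse are inserted,
      which splits the displacement into two bounded factors.\<close>
    have "f ?ys \<otimes>\<^bsub>free_group Z\<^esub> inv\<^bsub>free_group Z\<^esub> (xs ! j) =
        (f ?ys \<otimes>\<^bsub>free_group Z\<^esub> inv\<^bsub>free_group Z\<^esub> (?ys ! i)) \<otimes>\<^bsub>free_group Z\<^esub>
        (?ys ! i \<otimes>\<^bsub>free_group Z\<^esub> inv\<^bsub>free_group Z\<^esub> (xs ! j))"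
      using in_A by (simp add: m_assoc m_assoc[symmetric, of "inv\<^bsub>free_group Z\<^esub> (?ys ! i)" "?ys ! i"] del: nth_map)
    then have "length (f ?ys \<otimes>\<^bsub>free_group Z\<^esub> inv\<^bsub>free_group Z\<^esub> (xs ! j)) \<le>
        length (f ?ys \<otimes>\<^bsub>free_group Z\<^esub> inv\<^bsub>free_group Z\<^esub> (?ys ! i)) +
        length (?ys ! i \<otimes>\<^bsub>free_group Z\<^esub> inv\<^bsub>free_group Z\<^esub> (xs ! j))"
      using length_mult_free_group_le by metis
    with i(2)[OF ys] j(2)[OF xs] i(1) m xs show ?thesis by (simp add: comp_fun_def)
  qed
  with comp j(1) show "(n, comp_fun ?A n f gs) \<in> bounded_displacement Z"
    unfolding bounded_displacement_def by blast
qed (auto simp: bounded_displacement_def)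

lemma bounded_displacement_left_equivariant:
  assumes Z: "infinite Z" and f: "(n, f) \<in> bounded_displacement Z"
    and equivariant: "\<And>c xs. c \<in> carrier (free_group Z) \<Longrightarrow> xs \<in> tuples (carrier (free_group Z)) n \<Longrightarrow>
      f (map (\<lambda>x. c \<otimes>\<^bsub>free_group Z\<^esub> x) xs) = c \<otimes>\<^bsub>free_group Z\<^esub> f xs"
  shows "\<exists>i<n. \<forall>xs\<in>tuples (carrier (free_group Z)) n. f xs = xs ! i"
proof -
  interpret group "free_group Z" by (rule group_free_group)
  let ?A = "carrier (free_group Z)"
  obtain i B where i: "i < n" "\<And>xs. xs \<in> tuples ?A n \<Longrightarrow>
      length (f xs \<otimes>\<^bsub>free_group Z\<^esub> inv\<^bsub>free_group Z\<^esub> (xs ! i)) \<le> B"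
    using f unfolding bounded_displacement_def by blast
  have "f xs = xs ! i" if xs: "xs \<in> tuples ?A n" for xs
  proof -
    let ?p = "f xs \<otimes>\<^bsub>free_group Z\<^esub> inv\<^bsub>free_group Z\<^esub> (xs ! i)"
    have in_A: "f xs \<in> ?A" "xs ! i \<in> ?A"
      using f xs i(1) operationsD[of n f ?A xs] nth_mem
      by (auto simp: bounded_displacement_def tuples_def)
    have "?p = []"
    proof (rule conjugates_bounded_imp_Nil[OF Z])
      fix c assume c: "c \<in> ?A"
      let ?ys = "map (\<lambda>x. c \<otimes>\<^bsub>free_group Z\<^esub> x) xs"
      have ys: "?ys \<in> tuples ?A n"
        using xs c by (auto simp: tuples_def)
      \<comment> \<open>Equivariance brings out \<open>c\<close> on the left, and inverting
        \<open>c x_i\<close> puts the inverse of \<open>c\<close> on the right. As \<open>i\<close>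
        and \<open>B\<close> do not depend on the tuple, the same bound holds for all conjugates of
        \<open>?p\<close>.\<close>
      have "f ?ys \<otimes>\<^bsub>free_group Z\<^esub> inv\<^bsub>free_group Z\<^esub> (?ys ! i) =
          c \<otimes>\<^bsub>free_group Z\<^esub> ?p \<otimes>\<^bsub>free_group Z\<^esub> inv\<^bsub>free_group Z\<^esub> c"
        using c in_A xs i(1) by (simp add: equivariant tuples_def inv_mult_group m_assoc)
      then show "length (c \<otimes>\<^bsub>free_group Z\<^esub> ?p \<otimes>\<^bsub>free_group Z\<^esub> inv\<^bsub>free_group Z\<^esub> c) \<le> B"
        using i(2)[OF ys] by simp
    qed (use in_A in simp)
    then show ?thesis
      using in_A inv_equality[of "f xs" "inv\<^bsub>free_group Z\<^esub> (xs ! i)"] by (simp add: one_free_group)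
  qed
  with i(1) show ?thesis by blast
qed


section \<open>The algebra on the free group\<close>

lemma tuples_1: "xs \<in> tuples A 1 \<longleftrightarrow> (\<exists>x\<in>A. xs = [x])"
  by (auto simp: tuples_def length_Suc_conv)

lemma tuples_2: "xs \<in> tuples A 2 \<longleftrightarrow> (\<exists>x\<in>A. \<exists>y\<in>A. xs = [x, y])"
  by (auto simp: tuples_def length_Suc_conv numeral_2_eq_2)

locale free_group_alg =
  fixes Z :: "'z set" and h :: "'z word \<Rightarrow> 'z"
  assumes h: "h \<in> carrier (free_group Z) \<rightarrow> Z"
begin

abbreviation "G \<equiv> free_group Z"
abbreviation "\<AA> \<equiv> free_group_algebra Z h"

sublocale group G by (rule group_free_group)

lemma carrier_alg [simp]: "carrier \<AA> = carrier G"
  by (simp add: free_group_algebra_def)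

lemma symbols_alg: "symbols \<AA> = Sym_nu ` carrier G \<union> {Sym_g}"
  by (simp add: free_group_algebra_def)

lemma arity_alg [simp]: "arity \<AA> (Sym_nu c) = 1" "arity \<AA> Sym_g = 2"
  by (simp_all add: free_group_algebra_def)

lemma interp_alg [simp]:
  "interp \<AA> (Sym_nu c) xs = c \<otimes>\<^bsub>G\<^esub> xs ! 0"
  "interp \<AA> Sym_g xs = gen (h (xs ! 0 \<otimes>\<^bsub>G\<^esub> inv\<^bsub>G\<^esub> (xs ! 1))) \<otimes>\<^bsub>G\<^esub> xs ! 1"
  by (simp_all add: free_group_algebra_def)

lemma gen_h_closed [simp]: "u \<in> carrier G \<Longrightarrow> gen (h u) \<in> carrier G"
  using h by (intro gen_in_free_group) auto

section \<open>Subalgebras, bases and endomorphisms\<close>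

lemma is_algebra_alg: "is_algebra \<AA>"
  by (auto simp: is_algebra_def symbols_alg tuples_1 tuples_2 simp del: One_nat_def)

text \<open>There are no nullary symbols, so the empty set is closed under all operations.\<close>

lemma generated_subalgebra_empty: "generated_subalgebra \<AA> {} = {}"
proof -
  have "is_subuniverse \<AA> {}"
    by (auto simp: is_subuniverse_def symbols_alg tuples_1 tuples_2 simp del: One_nat_def)
  then show ?thesis
    using hull_minimal[of "{}" "{}" "is_subuniverse \<AA>"] by (simp add: generated_subalgebra_def)
qed

lemma generated_subalgebra_nonempty:
  assumes X: "X \<subseteq> carrier G" "x \<in> X"
  shows "generated_subalgebra \<AA> X = carrier G"
proof
  have "is_subuniverse \<AA> (carrier G)"
    using is_algebra_alg by (auto simp: is_subuniverse_def is_algebra_def)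
  then show "generated_subalgebra \<AA> X \<subseteq> carrier G"
    unfolding generated_subalgebra_def using X(1) by (intro hull_minimal)
next
  show "carrier G \<subseteq> generated_subalgebra \<AA> X"
    unfolding generated_subalgebra_def hull_def
  proof (intro subsetI InterI, elim CollectE conjE)
    fix y S assume y: "y \<in> carrier G" and S: "is_subuniverse \<AA> S" "X \<subseteq> S"
    have x: "x \<in> carrier G" "[x] \<in> tuples S 1"
      using X S(2) by (auto simp: tuples_1 simp del: One_nat_def)
    \<comment> \<open>Left translation by this element carries \<open>x\<close> to
      \<open>y\<close>.\<close>
    let ?c = "y \<otimes>\<^bsub>G\<^esub> inv\<^bsub>G\<^esub> x"
    have "Sym_nu ?c \<in> symbols \<AA>"
      using x y by (simp add: symbols_alg)
    then have "interp \<AA> (Sym_nu ?c) [x] \<in> S"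
      using S(1) x(2) unfolding is_subuniverse_def by (metis arity_alg(1))
    then show "y \<in> S"
      using x y by (simp add: m_assoc)
  qed
qed

text \<open>Associativity handles the left translations. For the binary operation, the quotient
  \<open>u v^-1\<close> to which \<open>h\<close> is applied is unchanged when both arguments are
  multiplied by \<open>d\<close> on the right.\<close>

lemma is_endomorphism_right_translation:
  assumes d: "d \<in> carrier G"
  shows "is_endomorphism \<AA> (\<lambda>w. w \<otimes>\<^bsub>G\<^esub> d)"
proof -
  have "(u \<otimes>\<^bsub>G\<^esub> d) \<otimes>\<^bsub>G\<^esub> inv\<^bsub>G\<^esub> (v \<otimes>\<^bsub>G\<^esub> d) = u \<otimes>\<^bsub>G\<^esub> inv\<^bsub>G\<^esub> v"
    if "u \<in> carrier G" "v \<in> carrier G" for u v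
  proof -
    have "d \<otimes>\<^bsub>G\<^esub> (inv\<^bsub>G\<^esub> d \<otimes>\<^bsub>G\<^esub> inv\<^bsub>G\<^esub> v) = inv\<^bsub>G\<^esub> v"
      using d that by (simp add: m_assoc[symmetric])
    with d that show ?thesis by (simp add: inv_mult_group m_assoc)
  qed
  with d show ?thesis
    by (auto simp: is_endomorphism_def symbols_alg tuples_1 tuples_2 m_assoc simp del: One_nat_def)
qed

lemma independence_algebra_alg: "independence_algebra \<AA>"
  unfolding independence_algebra_def
proof (intro conjI allI impI is_algebra_alg)
  fix X y z
  assume "X \<subseteq> carrier \<AA>" "y \<in> carrier \<AA>" "z \<in> carrier \<AA>"
  then show "z \<in> generated_subalgebra \<AA> (X \<union> {y})"
    using generated_subalgebra_nonempty[of "X \<union> {y}" y] by simp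
next
  fix X \<alpha> assume X: "is_basis \<AA> X" and \<alpha>: "\<alpha> \<in> X \<rightarrow> carrier \<AA>"
  \<comment> \<open>The empty set generates only itself, whereas the carrier contains the
    identity.\<close>
  have "X \<noteq> {}"
    using X generated_subalgebra_empty one_closed by (auto simp: is_basis_def)
  then obtain x where x: "x \<in> X" "x \<in> carrier G"
    using X by (auto simp: is_basis_def)
  \<comment> \<open>A second element \<open>y\<close> would be redundant, since \<open>x\<close>
    alone already generates everything.\<close>
  have "y = x" if "y \<in> X" for y
  proof (rule ccontr)
    assume "y \<noteq> x"
    then have "generated_subalgebra \<AA> (X - {y}) = carrier G"
      using X x by (intro generated_subalgebra_nonempty[of _ x]) (auto simp: is_basis_def)
    with X that show False by (auto simp: is_basis_def)
  qed
  moreover have "\<alpha> x \<in> carrier G"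
    using \<alpha> x by auto
  \<comment> \<open>Right translation by \<open>x^-1 \<alpha>(x)\<close> sends \<open>x\<close> to
    \<open>\<alpha> x\<close>.\<close>
  moreover from this have "x \<otimes>\<^bsub>G\<^esub> (inv\<^bsub>G\<^esub> x \<otimes>\<^bsub>G\<^esub> \<alpha> x) = \<alpha> x"
    using x by (simp add: m_assoc[symmetric])
  ultimately show "\<exists>\<phi>. is_endomorphism \<AA> \<phi> \<and> (\<forall>x\<in>X. \<phi> x = \<alpha> x)"
    using x is_endomorphism_right_translation[of "inv\<^bsub>G\<^esub> x \<otimes>\<^bsub>G\<^esub> \<alpha> x"]
    by (metis inv_closed m_closed)
qed

section \<open>Failure of the distributivity condition\<close>

lemma basic_operation:
  assumes "f \<in> symbols \<AA>"
  shows "(arity \<AA> f, restrict (interp \<AA> f) (tuples (carrier G) (arity \<AA> f))) \<in> operations (carrier G)"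
proof -
  have "arity \<AA> f \<ge> 1"
    using assms by (auto simp: symbols_alg)
  with assms show ?thesis
    using is_algebra_alg by (auto simp: is_algebra_def operations_def simp del: One_nat_def)
qed

text \<open>It suffices to check the generators: the displacement of a left translation is
  \<open>c\<close> itself, and that of the binary operation from its second argument is a single
  letter.\<close>

lemma clone_of_subset_bounded_displacement: "clone_of \<AA> \<subseteq> bounded_displacement Z"
  unfolding clone_of_def carrier_alg
proof (rule generated_clone_minimal[OF _ is_clone_bounded_displacement], clarify)
  fix f assume f: "f \<in> symbols \<AA>"
  show "(arity \<AA> f, restrict (interp \<AA> f) (tuples (carrier G) (arity \<AA> f))) \<in> bounded_displacement Z"
  proof (cases f)
    case (Sym_nu c)
    then have "length (interp \<AA> f xs \<otimes>\<^bsub>G\<^esub> inv\<^bsub>G\<^esub> (xs ! 0)) \<le> length c"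
      if "xs \<in> tuples (carrier G) 1" for xs
      using that f by (auto simp: tuples_1 symbols_alg m_assoc simp del: One_nat_def)
    with Sym_nu show ?thesis
      using basic_operation[OF f] by (auto simp: bounded_displacement_def simp del: interp_alg)
  next
    case Sym_g
    then have "length (interp \<AA> f xs \<otimes>\<^bsub>G\<^esub> inv\<^bsub>G\<^esub> (xs ! 1)) \<le> 1"
      if "xs \<in> tuples (carrier G) 2" for xs
      using that by (auto simp: tuples_2 m_assoc) (simp add: gen_def)
    with Sym_g show ?thesis
      using basic_operation[OF f] unfolding bounded_displacement_def
      by (auto simp del: interp_alg intro!: exI[of _ 1])
  qed
qed

lemma g_in_clone_of: "(2, restrict (interp \<AA> Sym_g) (tuples (carrier G) 2)) \<in> clone_of \<AA>"
proof -
  have "(arity \<AA> Sym_g, restrict (interp \<AA> Sym_g) (tuples (carrier \<AA>) (arity \<AA> Sym_g)))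
      \<in> clone_of \<AA>"
    unfolding clone_of_def
    by (rule subsetD[OF subset_generated_clone]) (force simp: symbols_alg simp del: interp_alg)
  then show ?thesis by simp
qed

text \<open>This makes every left translation available as the unary operation in the distributivity
  condition. Its values at \<open>gen x\<close> and at the identity differ by left
  cancellation.\<close>

lemma left_translation_term_op:
  assumes c: "c \<in> carrier G" and x: "x \<in> Z"
  shows "restrict (\<lambda>xs. c \<otimes>\<^bsub>G\<^esub> xs ! 0) (tuples (carrier G) 1) \<in> nonconstant_unary_term_ops \<AA>"
proof -
  have "comp_fun (carrier \<AA>) 1 (interp \<AA> (Sym_nu c)) [proj_fun (carrier \<AA>) 1 0] \<in> term_ops \<AA> 1"
    using c term_ops.var[of 0 1 \<AA>] by (intro term_ops.app) (auto simp: symbols_alg)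
  also have "comp_fun (carrier \<AA>) 1 (interp \<AA> (Sym_nu c)) [proj_fun (carrier \<AA>) 1 0] =
      restrict (\<lambda>xs. c \<otimes>\<^bsub>G\<^esub> xs ! 0) (tuples (carrier G) 1)"
    by (auto simp: comp_fun_def proj_fun_def fun_eq_iff restrict_def)
  finally have "restrict (\<lambda>xs. c \<otimes>\<^bsub>G\<^esub> xs ! 0) (tuples (carrier G) 1) \<in> term_ops \<AA> 1" .
  moreover have "c \<otimes>\<^bsub>G\<^esub> gen x \<noteq> c \<otimes>\<^bsub>G\<^esub> \<one>\<^bsub>G\<^esub>"
    using c gen_in_free_group[OF x] by (simp del: r_one) (simp add: one_free_group gen_def)
  moreover have "[gen x] \<in> tuples (carrier G) 1" "[\<one>\<^bsub>G\<^esub>] \<in> tuples (carrier G) 1"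
    using gen_in_free_group[OF x] one_closed tuples_1[of _ "carrier G"] by blast+
  ultimately show ?thesis
    unfolding nonconstant_unary_term_ops_def carrier_alg
    using gen_in_free_group[OF x] one_closed
    by (intro CollectI conjI bexI[of _ "gen x"] bexI[of _ "\<one>\<^bsub>G\<^esub>"])
      (simp_all only: restrict_apply if_True nth_Cons_0 not_False_eq_True simp_thms)
qed

lemma g_not_essentially_unary:
  assumes "x \<in> Z" and inj: "inj_on h (carrier G)"
  shows "(2, restrict (interp \<AA> Sym_g) (tuples (carrier G) 2)) \<notin> essentially_unary (carrier G)"
proof
  let ?g = "restrict (interp \<AA> Sym_g) (tuples (carrier G) 2)"
  assume "(2, ?g) \<in> essentially_unary (carrier G)"
  then obtain i where i: "i < 2" "\<And>xs ys. xs \<in> tuples (carrier G) 2 \<Longrightarrow> ys \<in> tuples (carrier G) 2 \<Longrightarrow>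
      xs ! i = ys ! i \<Longrightarrow> ?g xs = ?g ys"
    unfolding essentially_unary_def by blast
  have x: "gen x \<in> carrier G" "\<one>\<^bsub>G\<^esub> \<in> carrier G"
    using gen_in_free_group[OF \<open>x \<in> Z\<close>] by auto
  have g: "?g [u, v] = gen (h (u \<otimes>\<^bsub>G\<^esub> inv\<^bsub>G\<^esub> v)) \<otimes>\<^bsub>G\<^esub> v" if "u \<in> carrier G" "v \<in> carrier G" for u v
    using that by (simp add: tuples_2)
  consider "i = 0" | "i = 1" using i(1) by linarith
  then show False
  proof cases
    case 1
    \<comment> \<open>Two positive letters never cancel, so the left side has length 2 and the right
      side length 1.\<close>
    have "?g [\<one>\<^bsub>G\<^esub>, gen x] = ?g [\<one>\<^bsub>G\<^esub>, \<one>\<^bsub>G\<^esub>]"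
      using 1 x by (intro i(2)) (auto simp: tuples_2)
    then show False
      unfolding g[OF x(2,1)] g[OF x(2,2)]
      by (simp add: mult_free_group one_free_group gen_def inv_letter_def)
  next
    case 2
    \<comment> \<open>With second argument the identity, the values are the letters
      \<open>h (gen x)\<close> and \<open>h\<close> of the identity, which injectivity
      separates.\<close>
    have "?g [gen x, \<one>\<^bsub>G\<^esub>] = ?g [\<one>\<^bsub>G\<^esub>, \<one>\<^bsub>G\<^esub>]"
      using 2 x by (intro i(2)) (auto simp: tuples_2)
    then have "gen (h (gen x)) = gen (h \<one>\<^bsub>G\<^esub>)"
      unfolding g[OF x] g[OF x(2,2)] using x by simp
    then have "h (gen x) = h \<one>\<^bsub>G\<^esub>"
      by (simp add: gen_def)
    then show False
      using inj_onD[OF inj _ x] by (simp add: gen_def one_free_group)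
  qed
qed

lemma not_distributivity_condition_alg:
  assumes Z: "infinite Z" and inj: "inj_on h (carrier G)"
  shows "\<not> distributivity_condition \<AA>"
proof
  assume "distributivity_condition \<AA>"
  then obtain W where W: "W \<subseteq> clone_of \<AA>" "generated_clone (carrier G) W = clone_of \<AA>"
    and "\<forall>a\<in>nonconstant_unary_term_ops \<AA>. \<forall>(n, t)\<in>W. n \<ge> 2 \<longrightarrow>
      (\<forall>xs\<in>tuples (carrier G) n. a [t xs] = t (map (\<lambda>x. a [x]) xs))"
    unfolding distributivity_condition_def carrier_alg by (elim exE conjE)
  then have distrib: "\<And>a n t xs. a \<in> nonconstant_unary_term_ops \<AA> \<Longrightarrow> (n, t) \<in> W \<Longrightarrow> n \<ge> 2 \<Longrightarrow>
      xs \<in> tuples (carrier G) n \<Longrightarrow> a [t xs] = t (map (\<lambda>x. a [x]) xs)"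
    by fast
  obtain x where x: "x \<in> Z"
    using Z by (metis ex_in_conv finite.emptyI)
  have "(n, t) \<in> essentially_unary (carrier G)" if t: "(n, t) \<in> W" for n t
  proof -
    have bd: "(n, t) \<in> bounded_displacement Z"
      using t W(1) clone_of_subset_bounded_displacement by blast
    then have op: "(n, t) \<in> operations (carrier G)"
      by (simp add: bounded_displacement_def)
    then consider "n = 1" | "n \<ge> 2"
      by (fastforce simp: operations_def)
    then show ?thesis
    proof cases
      case 1
      then show ?thesis
        using op by (auto simp: essentially_unary_def tuples_1 simp del: One_nat_def)
    next
      case 2
      have "t (map (\<lambda>y. c \<otimes>\<^bsub>G\<^esub> y) xs) = c \<otimes>\<^bsub>G\<^esub> t xs"
        if c: "c \<in> carrier G" and xs: "xs \<in> tuples (carrier G) n" for c xs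
      proof -
        let ?a = "restrict (\<lambda>xs. c \<otimes>\<^bsub>G\<^esub> xs ! 0) (tuples (carrier G) 1)"
        have a: "?a [y] = c \<otimes>\<^bsub>G\<^esub> y" if "y \<in> carrier G" for y
          using that tuples_1[of "[y]" "carrier G"] by simp
        have "map (\<lambda>y. c \<otimes>\<^bsub>G\<^esub> y) xs = map (\<lambda>y. ?a [y]) xs"
          using xs a by (auto simp: tuples_def simp del: restrict_apply)
        then show ?thesis
          \<comment> \<open>Distributivity over the left translation by \<open>c\<close> is exactly
            left equivariance of \<open>t\<close>.\<close>
          using distrib[OF left_translation_term_op[OF c x] t 2 xs] a[OF operationsD[OF op xs]]
          by (simp only:)
      qed
      from bounded_displacement_left_equivariant[OF Z bd this]
      obtain i where "i < n" "\<forall>xs\<in>tuples (carrier G) n. t xs = xs ! i" by blast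
      with op show ?thesis unfolding essentially_unary_def by auto
    qed
  qed
  \<comment> \<open>Being essentially unary passes from the generating set \<open>W\<close> to the
    whole clone, hence to the binary basic operation.\<close>
  then have "clone_of \<AA> \<subseteq> essentially_unary (carrier G)"
    unfolding W(2)[symmetric] by (intro generated_clone_minimal is_clone_essentially_unary) auto
  with g_in_clone_of g_not_essentially_unary[OF x inj] show False by blast
qed

end

theorem theorem2p4:
  fixes z :: "nat \<Rightarrow> 'z" and h :: "'z word \<Rightarrow> 'z"
    and Z E :: "'z set" and F :: "'z word monoid"
  assumes z_inj: "inj_on z {1..}"
    and Z: "Z = z ` {1..}"
    and E: "E = {z (2 * k) | k. k \<ge> 1}"
    and F: "F = free_group Z"
    and h_range: "h \<in> carrier F \<rightarrow> E"
    and h_inj: "inj_on h (carrier F)"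
    and h1: "h (gen (z 1) \<otimes>\<^bsub>F\<^esub> inv\<^bsub>F\<^esub> gen (z 2)) = z 6"
    and h2: "h (gen (z 3) \<otimes>\<^bsub>F\<^esub> inv\<^bsub>F\<^esub> gen (z 2)) = z 8"
    and h3: "h (gen (z 1) \<otimes>\<^bsub>F\<^esub> inv\<^bsub>F\<^esub> gen (z 4)) = z 10"
  shows "independence_algebra (free_group_algebra Z h)
    \<and> \<not> distributivity_condition (free_group_algebra Z h)"
proof -
  \<comment> \<open>Each index \<open>2 * k\<close> with \<open>k \<ge> 1\<close> is at least 1, so
    \<open>h\<close> also takes values in \<open>Z\<close>.\<close>
  have "E \<subseteq> Z"
    by (auto simp: E Z)
  then interpret free_group_alg Z h
    using h_range F by unfold_locales auto
  have "infinite Z"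
    using z_inj Z finite_imageD infinite_Ici by blast
  then show ?thesis
    using independence_algebra_alg not_distributivity_condition_alg h_inj F by simp
qed

end
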